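(* Let $b_1,b_2,b_3>0$ be real numbers and define $G^1:\mathbb{R}^3\to\mathbb{R}^6$ and $G^2:\mathbb{R}^3\to\mathbb{R}^3$ by $$G^1(x)=\begin{pmatrix} x_1-b_1\\ x_2-b_2\\ x_3-b_3\\ -x_1-b_1\\ -x_2-b_2\\ -x_3-b_3\end{pmatrix},\qquad G^2(x)=\begin{pmatrix} x_1-b_1\\ -x_1-b_1\\ x_2^2+x_3^2-b_2^2\end{pmatrix}.$$ Let $c=(c_1,c_2,c_3)^T\in\mathbb{R}^3$ be such that $c_1\neq 0$ and at least one of $c_2,c_3$ is nonzero, and let $$R=\frac{1}{\sqrt{c_2^2+c_3^2}}\begin{bmatrix}\sqrt{c_2^2+c_3^2}&0&0\\ 0&c_2&c_3\\ 0&-c_3&c_2\end{bmatrix}.$$ Let $T(x)=Rx$, so that $T^{-1}(x)=R^{-1}x$. Then $$T^{-1}\left(\mathbf{P}\left(G^1(x),\,T(c)\right)\right)=\mathbf{P}\left(G^2(x),\,c\right),$$ where $\mathbf{P}(G(x),c)$ denotes the central path of $G$ and $c$, and $T^{-1}$ of a set is the set of images of its elements under $T^{-1}$.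
   Context: Central path: let $G=(g_1,\dots,g_m)^T:\mathbb{R}^n\to\mathbb{R}^m$ have convex, twice smooth component functions, and suppose that $\{x: G(x)\le 0\}$ is compact and $\{x:G(x)<0\}\ne\emptyset$ (inequalities componentwise). For $c\in\mathbb{R}^n$ and $\mu>0$ consider the problem $$\max\left\{c^Tx+\mu\sum_{i=1}^m\ln(s_i)\;:\;G(x)+s=0,\ s\ge 0\right\},$$ with $x\in\mathbb{R}^n$, $s\in\mathbb{R}^m$, and the objective value taken to be $-\infty$ if some $s_i=0$. Write $(x(\mu),s(\mu))$ for its unique optimal solution. Equivalently, $(x(\mu),s(\mu))$ together with some $y\in\mathbb{R}^m$ satisfies $\nabla G(x)^Ty=c$, $y>0$, $G(x)+s=0$, $s>0$, and $s_iy_i=\mu$ for all $i$, where $\nabla G(x)$ is the $m\times n$ Jacobian. The central path is $\mathbf{P}(G(x),c)=\{x(\mu):\mu>0\}\subset\mathbb{R}^n$. The superscripts in $G^1$ and $G^2$ are labels, not powers. *)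

theory Defs
  imports "HOL-Analysis.Analysis"
begin

definition barrier_feasible ::
  "(real^'n \<Rightarrow> real^'m) \<Rightarrow> (real^'n) \<times> (real^'m) \<Rightarrow> bool" where
  "barrier_feasible G = (\<lambda>(x, s). G x + s = 0 \<and> (\<forall>i. s $ i \<ge> 0))"

definition barrier_objective ::
  "real^'n \<Rightarrow> real \<Rightarrow> (real^'n) \<times> (real^'m) \<Rightarrow> ereal" where
  "barrier_objective c \<mu> = (\<lambda>(x, s).
     if \<exists>i. s $ i = 0 then - \<infinity>
     else ereal (c \<bullet> x + \<mu> * (\<Sum>i\<in>UNIV. ln (s $ i))))"

text \<open>
  When the maximizer \<open>(x(\<mu>), s(\<mu>))\<close> is unique for each \<open>\<mu> > 0\<close>, this is \<open>{x(\<mu>) | \<mu> > 0}\<close>.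
\<close>
definition central_path :: "(real^'n \<Rightarrow> real^'m) \<Rightarrow> real^'n \<Rightarrow> (real^'n) set" where
  "central_path G c =
     {x. \<exists>\<mu> > 0. \<exists>s. is_arg_max (barrier_objective c \<mu>) (barrier_feasible G) (x, s)}"

definition G1 :: "real \<Rightarrow> real \<Rightarrow> real \<Rightarrow> real^3 \<Rightarrow> real^6" where
  "G1 b1 b2 b3 x = vector [x $ 1 - b1, x $ 2 - b2, x $ 3 - b3,
                           - x $ 1 - b1, - x $ 2 - b2, - x $ 3 - b3]"

definition G2 :: "real \<Rightarrow> real \<Rightarrow> real \<Rightarrow> real^3 \<Rightarrow> real^3" where
  "G2 b1 b2 b3 x = vector [x $ 1 - b1, - x $ 1 - b1, (x $ 2)\<^sup>2 + (x $ 3)\<^sup>2 - b2\<^sup>2]"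

definition R_mat :: "real^3 \<Rightarrow> real^3^3" where
  "R_mat c = (1 / sqrt ((c $ 2)\<^sup>2 + (c $ 3)\<^sup>2)) *\<^sub>R
     vector [vector [sqrt ((c $ 2)\<^sup>2 + (c $ 3)\<^sup>2), 0, 0],
             vector [0, c $ 2, c $ 3],
             vector [0, - c $ 3, c $ 2]]"

definition T_map :: "real^3 \<Rightarrow> real^3 \<Rightarrow> real^3" where
  "T_map c x = R_mat c *v x"

end

theory Submission
  imports Defs
begin

text \<open>
  For fixed \<open>\<mu>\<close>, a point of the central path is a strictly feasible maximizer of the logarithmic
  barrier function \<open>c \<bullet> x + \<mu> * (\<Sum>i. ln (- G x $ i))\<close> (\<open>mem_central_path_iff\<close>): eliminating the
  slack variables costs nothing, and boundary points, where the objective is \<open>- \<infinity>\<close>, never win as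
  soon as one strictly feasible point exists.

  The map \<open>T\<close> is a rotation about the first axis that takes \<open>c\<close> to \<open>(c\<^sub>1, r, 0)\<close> with
  \<open>r = sqrt (c\<^sub>2\<^sup>2 + c\<^sub>3\<^sup>2)\<close>. The cylinder \<open>G2 b1 b2 b3 x \<le> 0\<close> is invariant under it, so
  \<open>T\<close> carries the central path of \<open>G2\<close> and \<open>c\<close> to that of \<open>G2\<close> and \<open>T c\<close>
  (\<open>mem_central_path_rotate\<close>,
  \<open>G2_T_map\<close>). It remains to see that the box and the cylinder have the same
  central path when the third component of the objective vanishes. In both cases replacing \<open>x\<^sub>3\<close>
  by \<open>0\<close> keeps a point strictly feasible and strictly increases the barrier function unless
  \<open>x\<^sub>3 = 0\<close> already, so all maximizers lie in the plane \<open>x\<^sub>3 = 0\<close>. In this plane the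
  two strictly feasible regions are the same rectangle, and because
  \<open>ln (b\<^sub>2 - x\<^sub>2) + ln (b\<^sub>2 + x\<^sub>2) = ln (b\<^sub>2\<^sup>2 - x\<^sub>2\<^sup>2)\<close> the two barrier functions differ
  there only by the constant \<open>2 * \<mu> * ln b\<^sub>3\<close>. They therefore have the same maximizers, for every
  single \<open>\<mu>\<close> (\<open>central_path_G1_eq_G2\<close>).
\<close>

section \<open>Eliminating the slack variables\<close>

definition strictly_feasible :: "(real^'n \<Rightarrow> real^'m) \<Rightarrow> real^'n \<Rightarrow> bool" where
  "strictly_feasible G x \<longleftrightarrow> (\<forall>i. G x $ i < 0)"

definition log_barrier :: "(real^'n \<Rightarrow> real^'m) \<Rightarrow> real^'n \<Rightarrow> real \<Rightarrow> real^'n \<Rightarrow> real" where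
  "log_barrier G c \<mu> x = c \<bullet> x + \<mu> * (\<Sum>i\<in>UNIV. ln (- G x $ i))"

text \<open>
  The slack vector of a feasible pair is \<open>- G x\<close>, and a pair with a vanishing slack has value
  \<open>- \<infinity>\<close>, which any strictly feasible point beats.
\<close>

lemma is_arg_max_barrier_iff:
  assumes slater: "strictly_feasible G z"
  shows "(\<exists>s. is_arg_max (barrier_objective c \<mu>) (barrier_feasible G) (x, s)) \<longleftrightarrow>
         is_arg_max (log_barrier G c \<mu>) (strictly_feasible G) x"
proof -
  have slack: "s = - G y" if "barrier_feasible G (y, s)" for y s
    using that by (simp add: barrier_feasible_def eq_neg_iff_add_eq_0 add.commute)
  have feas: "barrier_feasible G (y, - G y) \<longleftrightarrow> (\<forall>i. G y $ i \<le> 0)" for y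
    by (simp add: barrier_feasible_def)
  have strict_obj: "barrier_objective c \<mu> (y, - G y) = ereal (log_barrier G c \<mu> y)"
    if "strictly_feasible G y" for y
  proof -
    have "\<not> (\<exists>i. G y $ i = 0)" using that by (auto simp: strictly_feasible_def less_le)
    then show ?thesis by (simp add: barrier_objective_def log_barrier_def)
  qed
  have bdry_obj: "barrier_objective c \<mu> (y, - G y) = - \<infinity>"
    if "\<not> strictly_feasible G y" "barrier_feasible G (y, - G y)" for y
  proof -
    have "\<exists>i. G y $ i = 0"
      using that unfolding feas strictly_feasible_def by (metis antisym_conv2)
    then show ?thesis by (auto simp: barrier_objective_def)
  qed
  have strict_feas: "barrier_feasible G (y, - G y)" if "strictly_feasible G y" for y
    using that by (auto simp: feas strictly_feasible_def less_imp_le)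
  show ?thesis
  proof
    assume "\<exists>s. is_arg_max (barrier_objective c \<mu>) (barrier_feasible G) (x, s)"
    then obtain s where s: "is_arg_max (barrier_objective c \<mu>) (barrier_feasible G) (x, s)" ..
    then have "s = - G x" unfolding is_arg_max_def by (intro slack) (rule conjunct1)
    with s have xf: "barrier_feasible G (x, - G x)"
      and opt: "\<And>y. barrier_feasible G (y, - G y) \<Longrightarrow>
        \<not> barrier_objective c \<mu> (x, - G x) < barrier_objective c \<mu> (y, - G y)"
      unfolding is_arg_max_def by blast+
    have xs: "strictly_feasible G x"
    proof (rule ccontr)
      assume "\<not> strictly_feasible G x"
      then show False
        using opt[OF strict_feas[OF slater]] strict_obj[OF slater] bdry_obj[OF _ xf] by simp
    qed
    have "\<not> log_barrier G c \<mu> x < log_barrier G c \<mu> y" if "strictly_feasible G y" for y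
      using opt[OF strict_feas[OF that]] by (simp add: strict_obj xs that)
    with xs show "is_arg_max (log_barrier G c \<mu>) (strictly_feasible G) x"
      by (simp add: is_arg_max_def)
  next
    assume opt: "is_arg_max (log_barrier G c \<mu>) (strictly_feasible G) x"
    then have xs: "strictly_feasible G x" by (simp add: is_arg_max_def)
    have "\<not> barrier_objective c \<mu> (x, - G x) < barrier_objective c \<mu> p"
      if p: "barrier_feasible G p" for p
    proof -
      obtain y where y: "p = (y, - G y)"
        using p slack by (metis surj_pair)
      show ?thesis
        using opt strict_obj[OF xs] strict_obj[of y] bdry_obj[of y] p
        by (cases "strictly_feasible G y") (auto simp: y is_arg_max_def)
    qed
    then have "is_arg_max (barrier_objective c \<mu>) (barrier_feasible G) (x, - G x)"
      using strict_feas[OF xs] by (auto simp: is_arg_max_def)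
    then show "\<exists>s. is_arg_max (barrier_objective c \<mu>) (barrier_feasible G) (x, s)" ..
  qed
qed

lemma mem_central_path_iff:
  assumes "strictly_feasible G z"
  shows "x \<in> central_path G c \<longleftrightarrow>
         (\<exists>\<mu>>0. is_arg_max (log_barrier G c \<mu>) (strictly_feasible G) x)"
  using is_arg_max_barrier_iff[OF assms] by (simp add: central_path_def)

section \<open>Orthogonal symmetries of the constraints\<close>

text \<open>
  Since \<open>T\<close> preserves the inner product, the barrier function for \<open>T c\<close> at \<open>T x\<close> equals the
  one for \<open>c\<close> at \<open>x\<close>; since \<open>T\<close> is onto, comparing with all \<open>T y\<close> is comparing with
  all points.
\<close>

lemma mem_central_path_rotate:
  assumes T: "orthogonal_transformation T" and inv: "\<And>x. G (T x) = G x"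
    and slater: "strictly_feasible G z"
  shows "T x \<in> central_path G (T c) \<longleftrightarrow> x \<in> central_path G c"
proof -
  have "surj T" using T by (rule orthogonal_transformation_surj)
  then have "(\<exists>y. Q y) \<longleftrightarrow> (\<exists>y. Q (T y))" for Q
    by (metis surjD)
  then have "is_arg_max f P (T x) \<longleftrightarrow> is_arg_max (f \<circ> T) (P \<circ> T) x"
    for f :: "_ \<Rightarrow> real" and P
    unfolding is_arg_max_def comp_def
    by (intro arg_cong2[of _ _ _ _ "(\<and>)"] refl arg_cong[of _ _ Not])
  moreover have "log_barrier G (T c) \<mu> \<circ> T = log_barrier G c \<mu>" for \<mu>
    using T by (auto simp: log_barrier_def inv orthogonal_transformation_def)
  moreover have "strictly_feasible G \<circ> T = strictly_feasible G"
    by (auto simp: strictly_feasible_def inv)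
  ultimately show ?thesis
    by (simp add: mem_central_path_iff[OF slater])
qed

section \<open>Maximizers lie in the range of an improving projection\<close>

text \<open>
  A maximizer must be a fixed point of \<open>p\<close>, or its image would be better. Conversely, any point
  \<open>y\<close> is dominated by its image \<open>p y\<close>, so a best fixed point is best overall. This reduces
  each of the two problems below to the plane \<open>x\<^sub>3 = 0\<close>, where they can be compared.
\<close>

lemma is_arg_max_retract:
  fixes f :: "'a \<Rightarrow> 'b::linorder"
  assumes idem: "\<And>x. p (p x) = p x"
    and feas: "\<And>x. P x \<Longrightarrow> P (p x)"
    and improve: "\<And>x. P x \<Longrightarrow> p x \<noteq> x \<Longrightarrow> f x < f (p x)"
  shows "is_arg_max f P x \<longleftrightarrow> is_arg_max f (\<lambda>x. P x \<and> p x = x) x"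
proof
  assume "is_arg_max f P x"
  then show "is_arg_max f (\<lambda>x. P x \<and> p x = x) x"
    using feas improve by (auto simp: is_arg_max_def)
next
  assume x: "is_arg_max f (\<lambda>x. P x \<and> p x = x) x"
  have "f y \<le> f x" if "P y" for y
  proof -
    have "f y \<le> f (p y)" using improve[OF that] by (cases "p y = y") auto
    also have "\<dots> \<le> f x" using x feas[OF that] idem by (auto simp: is_arg_max_def not_less)
    finally show ?thesis .
  qed
  then show "is_arg_max f P x"
    using x by (auto simp: is_arg_max_def not_less)
qed

definition flatten :: "real^3 \<Rightarrow> real^3" where
  "flatten x = vector [x $ 1, x $ 2, 0]"

lemma flatten_nth [simp]:
  "flatten x $ 1 = x $ 1" "flatten x $ 2 = x $ 2" "flatten x $ 3 = 0"
  by (simp_all add: flatten_def vector_3)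

lemma flatten_eq_iff: "flatten x = x \<longleftrightarrow> x $ 3 = 0"
  by (auto simp: vec_eq_iff forall_3)

section \<open>The box and the cylinder\<close>

lemma UNIV_6: "(UNIV :: 6 set) = {1, 2, 3, 4, 5, 6}"
proof -
  have "card {1, 2, 3, 4, 5, 6 :: 6} = 6" by simp
  then show ?thesis
    by (intro card_subset_eq[symmetric]) (auto simp: card_UNIV)
qed

lemma sum_6: "sum f (UNIV :: 6 set) = f 1 + f 2 + f 3 + f 4 + f 5 + f 6"
  unfolding UNIV_6 by (simp add: add.assoc)

lemma G1_nth:
  "G1 b1 b2 b3 x $ 1 = x $ 1 - b1" "G1 b1 b2 b3 x $ 2 = x $ 2 - b2" "G1 b1 b2 b3 x $ 3 = x $ 3 - b3"
  "G1 b1 b2 b3 x $ 4 = - x $ 1 - b1" "G1 b1 b2 b3 x $ 5 = - x $ 2 - b2"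
  "G1 b1 b2 b3 x $ 6 = - x $ 3 - b3"
  by (simp_all add: G1_def vector_def)

lemma G2_nth:
  "G2 b1 b2 b3 x $ 1 = x $ 1 - b1" "G2 b1 b2 b3 x $ 2 = - x $ 1 - b1"
  "G2 b1 b2 b3 x $ 3 = (x $ 2)\<^sup>2 + (x $ 3)\<^sup>2 - b2\<^sup>2"
  by (simp_all add: G2_def vector_3)

lemma strictly_feasible_G1:
  "strictly_feasible (G1 b1 b2 b3) x \<longleftrightarrow> \<bar>x $ 1\<bar> < b1 \<and> \<bar>x $ 2\<bar> < b2 \<and> \<bar>x $ 3\<bar> < b3"
proof -
  have "strictly_feasible (G1 b1 b2 b3) x \<longleftrightarrow> (\<forall>i\<in>{1, 2, 3, 4, 5, 6}. G1 b1 b2 b3 x $ i < 0)"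
    unfolding strictly_feasible_def UNIV_6[symmetric] by simp
  then show ?thesis by (simp add: G1_nth abs_less_iff) linarith
qed

lemma strictly_feasible_G2:
  "strictly_feasible (G2 b1 b2 b3) x \<longleftrightarrow> \<bar>x $ 1\<bar> < b1 \<and> (x $ 2)\<^sup>2 + (x $ 3)\<^sup>2 < b2\<^sup>2"
  by (auto simp: strictly_feasible_def forall_3 G2_nth)

lemma power2_less_iff_abs_less:
  fixes b t :: real
  assumes "b > 0"
  shows "t\<^sup>2 < b\<^sup>2 \<longleftrightarrow> \<bar>t\<bar> < b"
  using abs_le_square_iff[of b t] assms by linarith

lemma ln_diff_add_ln_sum:
  fixes b t :: real
  assumes "\<bar>t\<bar> < b"
  shows "ln (b - t) + ln (b + t) = ln (b\<^sup>2 - t\<^sup>2)"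
proof -
  have "ln (b - t) + ln (b + t) = ln ((b - t) * (b + t))"
    using assms by (intro ln_mult_pos[symmetric]) auto
  also have "(b - t) * (b + t) = b\<^sup>2 - t\<^sup>2" by (simp add: algebra_simps power2_eq_square)
  finally show ?thesis .
qed

lemma log_barrier_G1:
  assumes "strictly_feasible (G1 b1 b2 b3) x"
  shows "log_barrier (G1 b1 b2 b3) c \<mu> x =
    c \<bullet> x + \<mu> * (ln (b1\<^sup>2 - (x $ 1)\<^sup>2) + ln (b2\<^sup>2 - (x $ 2)\<^sup>2) + ln (b3\<^sup>2 - (x $ 3)\<^sup>2))"
proof -
  have lt: "\<bar>x $ 1\<bar> < b1" "\<bar>x $ 2\<bar> < b2" "\<bar>x $ 3\<bar> < b3"
    using assms by (simp_all add: strictly_feasible_G1)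
  have "(\<Sum>i\<in>UNIV. ln (- G1 b1 b2 b3 x $ i)) =
    (ln (b1 - x $ 1) + ln (b1 + x $ 1)) + (ln (b2 - x $ 2) + ln (b2 + x $ 2)) +
    (ln (b3 - x $ 3) + ln (b3 + x $ 3))"
    by (simp only: sum_6 G1_nth) simp
  then show ?thesis
    by (simp only: log_barrier_def ln_diff_add_ln_sum lt)
qed

lemma log_barrier_G2:
  assumes "strictly_feasible (G2 b1 b2 b3) x"
  shows "log_barrier (G2 b1 b2 b3) c \<mu> x =
    c \<bullet> x + \<mu> * (ln (b1\<^sup>2 - (x $ 1)\<^sup>2) + ln (b2\<^sup>2 - (x $ 2)\<^sup>2 - (x $ 3)\<^sup>2))"
proof -
  have lt: "\<bar>x $ 1\<bar> < b1"
    using assms by (simp add: strictly_feasible_G2)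
  have "(\<Sum>i\<in>UNIV. ln (- G2 b1 b2 b3 x $ i)) =
    (ln (b1 - x $ 1) + ln (b1 + x $ 1)) + ln (b2\<^sup>2 - (x $ 2)\<^sup>2 - (x $ 3)\<^sup>2)"
    by (simp add: sum_3 G2_nth diff_diff_eq)
  then show ?thesis
    by (simp only: log_barrier_def ln_diff_add_ln_sum lt)
qed

text \<open>
  The projection onto the plane \<open>x\<^sub>3 = 0\<close> improves both barrier functions: in the box it raises
  \<open>ln (b3\<^sup>2 - (x $ 3)\<^sup>2)\<close>, in the cylinder \<open>ln (b2\<^sup>2 - (x $ 2)\<^sup>2 - (x $ 3)\<^sup>2)\<close>, and the linear
  term does not see the third coordinate. On the plane itself the two problems agree up to a
  constant.
\<close>

lemma central_path_G1_eq_G2: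
  fixes c :: "real^3"
  assumes b: "b1 > 0" "b2 > 0" "b3 > 0" and c3: "c $ 3 = 0"
  shows "central_path (G1 b1 b2 b3) c = central_path (G2 b1 b2 b3) c"
proof -
  let ?S1 = "strictly_feasible (G1 b1 b2 b3)" and ?S2 = "strictly_feasible (G2 b1 b2 b3)"
  have slater: "?S1 0" "?S2 0"
    using b by (simp_all add: strictly_feasible_G1 strictly_feasible_G2)
  have inner_flatten: "c \<bullet> flatten x = c \<bullet> x" for x
    using c3 by (simp add: inner_vec_def sum_3)
  have feas1: "?S1 (flatten x)" if "?S1 x" for x
    using that b by (simp add: strictly_feasible_G1)
  have feas2: "?S2 (flatten x)" if "?S2 x" for x
  proof -
    have "0 \<le> (x $ 3)\<^sup>2" by simp
    then show ?thesis using that unfolding strictly_feasible_G2 flatten_nth by (simp; linarith)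
  qed
  have "is_arg_max (log_barrier (G1 b1 b2 b3) c \<mu>) ?S1 x \<longleftrightarrow>
        is_arg_max (log_barrier (G2 b1 b2 b3) c \<mu>) ?S2 x" if \<mu>: "\<mu> > 0" for \<mu> x
  proof -
    let ?L1 = "log_barrier (G1 b1 b2 b3) c \<mu>" and ?L2 = "log_barrier (G2 b1 b2 b3) c \<mu>"
    have improve1: "?L1 y < ?L1 (flatten y)" if y: "?S1 y" "flatten y \<noteq> y" for y
    proof -
      have "(y $ 3)\<^sup>2 < b3\<^sup>2"
        using y by (simp add: strictly_feasible_G1 power2_less_iff_abs_less[OF b(3)])
      moreover have "0 < (y $ 3)\<^sup>2" using y by (simp add: flatten_eq_iff)
      ultimately have "ln (b3\<^sup>2 - (y $ 3)\<^sup>2) < ln (b3\<^sup>2)"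
        by (subst ln_less_cancel_iff) auto
      then show ?thesis
        using \<mu> y by (simp add: log_barrier_G1 feas1 inner_flatten)
    qed
    have improve2: "?L2 y < ?L2 (flatten y)" if y: "?S2 y" "flatten y \<noteq> y" for y
    proof -
      have "0 < b2\<^sup>2 - (y $ 2)\<^sup>2 - (y $ 3)\<^sup>2"
        using y by (simp add: strictly_feasible_G2)
      moreover have "0 < (y $ 3)\<^sup>2" using y by (simp add: flatten_eq_iff)
      ultimately have "ln (b2\<^sup>2 - (y $ 2)\<^sup>2 - (y $ 3)\<^sup>2) < ln (b2\<^sup>2 - (y $ 2)\<^sup>2)"
        by (subst ln_less_cancel_iff) linarith+
      then show ?thesis
        using \<mu> y by (simp add: log_barrier_G2 feas2 inner_flatten)
    qed
    have same_slice: "?S1 y \<and> flatten y = y \<longleftrightarrow> ?S2 y \<and> flatten y = y" for y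
      using b power2_less_iff_abs_less[OF b(2), of "y $ 2"]
      by (auto simp: strictly_feasible_G1 strictly_feasible_G2 flatten_eq_iff)
    have diff_slice: "?L1 y = ?L2 y + \<mu> * ln (b3\<^sup>2)" if "?S1 y" "flatten y = y" for y
      using that same_slice[of y]
      by (simp add: log_barrier_G1 log_barrier_G2 flatten_eq_iff distrib_left)
    have "is_arg_max ?L1 ?S1 x \<longleftrightarrow> is_arg_max ?L1 (\<lambda>y. ?S1 y \<and> flatten y = y) x"
      by (rule is_arg_max_retract) (auto simp: flatten_eq_iff intro: feas1 improve1)
    also have "\<dots> \<longleftrightarrow> is_arg_max ?L2 (\<lambda>y. ?S1 y \<and> flatten y = y) x"
      by (auto simp: is_arg_max_def diff_slice)
    also have "\<dots> \<longleftrightarrow> is_arg_max ?L2 (\<lambda>y. ?S2 y \<and> flatten y = y) x"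
      by (simp only: same_slice)
    also have "\<dots> \<longleftrightarrow> is_arg_max ?L2 ?S2 x"
      by (rule is_arg_max_retract[symmetric]) (auto simp: flatten_eq_iff intro: feas2 improve2)
    finally show ?thesis .
  qed
  then show ?thesis
    unfolding set_eq_iff mem_central_path_iff[OF slater(1)] mem_central_path_iff[OF slater(2)]
    by blast
qed

section \<open>The rotation\<close>

lemma T_map_nth:
  fixes c x :: "real^3"
  defines "r \<equiv> sqrt ((c $ 2)\<^sup>2 + (c $ 3)\<^sup>2)"
  assumes "c $ 2 \<noteq> 0 \<or> c $ 3 \<noteq> 0"
  shows "T_map c x $ 1 = x $ 1"
    and "T_map c x $ 2 = (c $ 2 * x $ 2 + c $ 3 * x $ 3) / r"
    and "T_map c x $ 3 = (c $ 2 * x $ 3 - c $ 3 * x $ 2) / r"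
proof -
  have "r \<noteq> 0" using assms by (simp add: sum_power2_eq_zero_iff)
  moreover have "T_map c x = (1 / r) *\<^sub>R vector [r * x $ 1, c $ 2 * x $ 2 + c $ 3 * x $ 3,
      c $ 2 * x $ 3 - c $ 3 * x $ 2]"
    unfolding T_map_def R_mat_def scaleR_matrix_vector_assoc[symmetric] r_def
    by (simp add: vec_eq_iff forall_3 matrix_vector_mult_def sum_3 vector_3)
  ultimately show "T_map c x $ 1 = x $ 1"
    and "T_map c x $ 2 = (c $ 2 * x $ 2 + c $ 3 * x $ 3) / r"
    and "T_map c x $ 3 = (c $ 2 * x $ 3 - c $ 3 * x $ 2) / r"
    by (simp_all add: vector_3)
qed

text \<open>
  In the last two coordinates, \<open>T\<close> is multiplication by the conjugate of \<open>c\<^sub>2 + i c\<^sub>3\<close>, divided by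
  its modulus. The computation is the polarized form of
  \<open>(a\<^sup>2 + b\<^sup>2) * (u\<^sup>2 + v\<^sup>2) = (a * u + b * v)\<^sup>2 + (a * v - b * u)\<^sup>2\<close>.
\<close>

lemma orthogonal_transformation_T_map:
  assumes c: "c $ 2 \<noteq> 0 \<or> c $ 3 \<noteq> 0"
  shows "orthogonal_transformation (T_map c)"
proof -
  let ?n = "(c $ 2)\<^sup>2 + (c $ 3)\<^sup>2"
  have n: "?n > 0" using c by (simp add: sum_power2_gt_zero_iff)
  have "T_map c v \<bullet> T_map c w = v \<bullet> w" for v w
  proof -
    have "T_map c v \<bullet> T_map c w = v $ 1 * w $ 1 +
      ((c $ 2 * v $ 2 + c $ 3 * v $ 3) * (c $ 2 * w $ 2 + c $ 3 * w $ 3) +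
       (c $ 2 * v $ 3 - c $ 3 * v $ 2) * (c $ 2 * w $ 3 - c $ 3 * w $ 2)) / ?n"
      by (simp add: inner_vec_def sum_3 T_map_nth[OF c] flip: add_divide_distrib)
    also have "(c $ 2 * v $ 2 + c $ 3 * v $ 3) * (c $ 2 * w $ 2 + c $ 3 * w $ 3) +
       (c $ 2 * v $ 3 - c $ 3 * v $ 2) * (c $ 2 * w $ 3 - c $ 3 * w $ 2) =
       ?n * (v $ 2 * w $ 2 + v $ 3 * w $ 3)"
      by (simp add: algebra_simps power2_eq_square)
    also have "v $ 1 * w $ 1 + ?n * (v $ 2 * w $ 2 + v $ 3 * w $ 3) / ?n = v \<bullet> w"
      using less_imp_neq[OF n] by (subst nonzero_mult_div_cancel_left) (auto simp: inner_vec_def sum_3)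
    finally show ?thesis .
  qed
  moreover have "linear (T_map c)"
    unfolding T_map_def by (rule matrix_vector_mul_linear)
  ultimately show ?thesis by (simp add: orthogonal_transformation_def)
qed

text \<open>
  The values of \<open>G2\<close> depend only on \<open>x\<^sub>1\<close> and \<open>x\<^sub>2\<^sup>2 + x\<^sub>3\<^sup>2\<close>; \<open>T\<close> fixes the former and
  preserves the norm, hence also the latter.
\<close>

lemma G2_T_map:
  assumes c: "c $ 2 \<noteq> 0 \<or> c $ 3 \<noteq> 0"
  shows "G2 b1 b2 b3 (T_map c x) = G2 b1 b2 b3 x"
proof -
  have fst: "T_map c x $ 1 = x $ 1" by (rule T_map_nth(1)[OF c])
  have "T_map c x \<bullet> T_map c x = x \<bullet> x"
    using orthogonal_transformation_T_map[OF c] by (simp add: orthogonal_transformation_def)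
  then have "(T_map c x $ 2)\<^sup>2 + (T_map c x $ 3)\<^sup>2 = (x $ 2)\<^sup>2 + (x $ 3)\<^sup>2"
    by (simp add: inner_vec_def sum_3 fst power2_eq_square)
  then show ?thesis by (simp add: G2_def fst)
qed

theorem theorem6:
  fixes b1 b2 b3 :: real and c :: "real^3"
  assumes "b1 > 0" and "b2 > 0" and "b3 > 0"
    and "c $ 1 \<noteq> 0" and "c $ 2 \<noteq> 0 \<or> c $ 3 \<noteq> 0"
  shows "inv (T_map c) ` central_path (G1 b1 b2 b3) (T_map c c) = central_path (G2 b1 b2 b3) c"
proof -
  have orth: "orthogonal_transformation (T_map c)"
    using assms(5) by (rule orthogonal_transformation_T_map)
  have slater: "strictly_feasible (G2 b1 b2 b3) 0"
    using assms(1,2) by (simp add: strictly_feasible_G2)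
  \<comment> \<open>\<open>T\<close> turns the objective into the plane in which box and cylinder coincide.\<close>
  have "T_map c c $ 3 = 0" by (simp add: T_map_nth(3)[OF assms(5)])
  then have same_path: "central_path (G1 b1 b2 b3) (T_map c c) = central_path (G2 b1 b2 b3) (T_map c c)"
    using assms(1-3) by (intro central_path_G1_eq_G2)
  have "inv (T_map c) ` central_path (G1 b1 b2 b3) (T_map c c) =
      T_map c -` central_path (G2 b1 b2 b3) (T_map c c)"
    unfolding same_path
    by (rule bij_vimage_eq_inv_image[symmetric, OF orthogonal_transformation_bij[OF orth]])
  also have "\<dots> = central_path (G2 b1 b2 b3) c"
    using mem_central_path_rotate[OF orth G2_T_map[OF assms(5)] slater] by auto
  finally show ?thesis .
qed

end
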